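(* Let $D\subset\mathbb{N}$ be a finite set that contains at least two elements and let $$X_{D}:=\{x\in(0,1)\setminus\mathbb{Q}: (a_n(x))\in D^{\mathbb{N}}\}.$$ Then $X_{D}$ contains numbers that are quadratically very well approximable but not quadratically Liouville.
   Context: $\mathbb{N}=\{1,2,\dots\}$. For $x\in(0,1)\setminus\mathbb{Q}$, $(a_n(x))\in\mathbb{N}^{\mathbb{N}}$ denotes the sequence of partial quotients of its continued fraction expansion $x=\cfrac{1}{a_1+\cfrac{1}{a_2+\cdots}}$. The height $H(\alpha)$ of an algebraic number $\alpha$ is the maximum of the moduli of the coefficients of its minimal polynomial (the primitive integer polynomial, e.g. $H(\sqrt2)=2$), and $\deg(\alpha)$ is the degree of its minimal polynomial. For $x\in\mathbb{R}$ and $n\in\mathbb{N}$, $w_n(x)$ is the supremum of the real numbers $\omega$ for which there exist infinitely many real algebraic numbers $\alpha$ with $\deg(\alpha)\le n$ satisfying $0<|x-\alpha|<H(\alpha)^{-\omega-1}$. $x\in\mathbb{R}$ is quadratically very well approximable if $w_2(x)>2$, and quadratically Liouville if $w_2(x)=\infty$. *)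

theory Defs
  imports "HOL-Library.Extended_Real" "HOL-Computational_Algebra.Computational_Algebra"
begin

section \<open>Continued fractions\<close>

definition gauss_map :: "real \<Rightarrow> real" where
  "gauss_map x = frac (1 / x)"

(* Partial quotients are numbered from 1, as in x = 1 / (a_1 + 1 / (a_2 + ...));
   the index 0 carries no meaning and is never used. *)
definition partial_quotient :: "real \<Rightarrow> nat \<Rightarrow> nat" where
  "partial_quotient x n = nat \<lfloor>1 / (gauss_map ^^ (n - 1)) x\<rfloor>"

lemma gauss_map_irrational:
  assumes "x \<in> {0<..<1} - \<rat>"
  shows "gauss_map x \<in> {0<..<1} - \<rat>"
proof -
  have "1 / x \<notin> \<rat>"
  proof
    assume "1 / x \<in> \<rat>"
    then have "inverse (1 / x) \<in> \<rat>" by (rule Rats_inverse)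
    with assms show False by simp
  qed
  moreover have "1 / x = frac (1 / x) + of_int \<lfloor>1 / x\<rfloor>"
    by (simp add: frac_def)
  ultimately have irr: "frac (1 / x) \<notin> \<rat>"
    by (metis Rats_add Rats_of_int)
  then have "frac (1 / x) \<noteq> 0" by (metis Rats_0)
  then have "0 < frac (1 / x)" using frac_ge_0[of "1 / x"] by linarith
  with irr show ?thesis
    by (simp add: gauss_map_def frac_lt_1)
qed

(* The step that, iterated, produces the continued fraction expansion of x. *)
lemma partial_quotient_step:
  assumes x: "x \<in> {0<..<1} - \<rat>" and n: "n \<ge> 1"
  shows "partial_quotient x n \<ge> 1"
    and "(gauss_map ^^ n) x \<in> {0<..<1} - \<rat>"
    and "(gauss_map ^^ (n - 1)) x = 1 / (real (partial_quotient x n) + (gauss_map ^^ n) x)"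
proof -
  have orbit: "(gauss_map ^^ k) x \<in> {0<..<1} - \<rat>" for k
    by (induction k) (use x gauss_map_irrational in auto)
  define y where "y = (gauss_map ^^ (n - 1)) x"
  have y: "0 < y" "y < 1" using orbit[of "n - 1"] by (auto simp: y_def)
  have fl: "\<lfloor>1 / y\<rfloor> \<ge> 1" using y by (simp add: le_floor_iff)
  then show "partial_quotient x n \<ge> 1"
    unfolding partial_quotient_def y_def[symmetric] by linarith
  show "(gauss_map ^^ n) x \<in> {0<..<1} - \<rat>" by (rule orbit)
  have "(gauss_map ^^ Suc (n - 1)) x = gauss_map y" by (simp add: y_def)
  then have "(gauss_map ^^ n) x = 1 / y - of_int \<lfloor>1 / y\<rfloor>"
    using n by (simp add: gauss_map_def frac_def)
  moreover have "real (partial_quotient x n) = of_int \<lfloor>1 / y\<rfloor>"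
    using fl unfolding partial_quotient_def y_def[symmetric] by linarith
  ultimately show "(gauss_map ^^ (n - 1)) x = 1 / (real (partial_quotient x n) + (gauss_map ^^ n) x)"
    by (simp add: y_def)
qed

definition cf_set :: "nat set \<Rightarrow> real set" where
  "cf_set D = {x \<in> {0<..<1} - \<rat>. \<forall>n\<ge>1. partial_quotient x n \<in> D}"


section \<open>Degree and height of an algebraic number\<close>

definition is_min_int_poly :: "real \<Rightarrow> int poly \<Rightarrow> bool" where
  "is_min_int_poly \<alpha> p \<longleftrightarrow>
     poly (map_poly of_int p) \<alpha> = 0 \<and> content p = 1 \<and> lead_coeff p > 0 \<and>
     (\<forall>q. q \<noteq> 0 \<and> poly (map_poly of_int q) \<alpha> = 0 \<longrightarrow> degree p \<le> degree q)"

lemma is_min_int_poly_ex1: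
  assumes "algebraic \<alpha>"
  shows "\<exists>!p. is_min_int_poly \<alpha> p"
proof -
  let ?z = "\<lambda>p :: int poly. poly (map_poly of_int p) \<alpha> = 0"
  have smult: "poly (map_poly of_int (smult c q)) \<alpha> = of_int c * poly (map_poly of_int q) \<alpha>"
    for c :: int and q
    by (simp add: poly_altdef degree_map_poly coeff_map_poly sum_distrib_left mult.assoc)
  have diff: "map_poly of_int (p - q) = map_poly of_int p - (map_poly of_int q :: real poly)"
    for p q :: "int poly"
    by (intro poly_eqI) (simp add: coeff_map_poly)
  have "\<exists>p. p \<noteq> 0 \<and> ?z p"
    using algebraicE'[OF assms] by metis
  then obtain p where p: "p \<noteq> 0" "?z p"
    and pmin: "\<And>q. q \<noteq> 0 \<and> ?z q \<Longrightarrow> degree p \<le> degree q"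
    using ex_has_least_nat[of "\<lambda>p. p \<noteq> 0 \<and> ?z p" _ degree] by metis
  define r where "r = smult (sgn (lead_coeff p)) (primitive_part p)"
  have lc: "lead_coeff p \<noteq> 0" using p(1) by simp
  have sgn0: "sgn (lead_coeff p) \<noteq> 0" using lc by (simp add: sgn_if)
  have pp: "p = smult (content p) (primitive_part p)" by simp
  have "?z (primitive_part p)"
    using p smult[of "content p" "primitive_part p"] by simp
  then have zr: "?z r" by (simp add: r_def smult)
  have degr: "degree r = degree p" using sgn0 by (simp add: r_def)
  have "content r = 1"
    using p(1) by (auto simp: r_def sgn_if content_primitive_part)
  moreover have "lead_coeff r > 0"
  proof -
    have c0: "content p > 0"
      using p(1) by (metis content_eq_zero_iff normalize_content normalize_int_def abs_ge_zero
          order_less_le)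
    have "lead_coeff p = content p * lead_coeff (primitive_part p)"
      by (metis pp lead_coeff_smult)
    then have "sgn (lead_coeff p) = sgn (lead_coeff (primitive_part p))"
      using c0 by (simp add: sgn_mult)
    moreover have "lead_coeff (primitive_part p) \<noteq> 0"
      unfolding leading_coeff_0_iff using p(1) by simp
    ultimately show ?thesis
      by (simp add: r_def sgn_if split: if_splits)
  qed
  ultimately have ex: "is_min_int_poly \<alpha> r"
    using zr pmin degr by (auto simp: is_min_int_poly_def)
  have uniq: "a = b" if a: "is_min_int_poly \<alpha> a" and b: "is_min_int_poly \<alpha> b" for a b
  proof -
    have a0: "a \<noteq> 0" "b \<noteq> 0" using a b by (auto simp: is_min_int_poly_def)
    have deg: "degree a = degree b"
      using a b a0 by (auto simp: is_min_int_poly_def intro!: antisym)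
    define d where "d = smult (lead_coeff b) a - smult (lead_coeff a) b"
    have "?z d" using a b by (simp add: d_def diff smult is_min_int_poly_def)
    moreover have "degree d < degree a" if "d \<noteq> 0"
    proof -
      have "degree d \<le> degree a"
        unfolding d_def by (intro degree_diff_le order.trans[OF degree_smult_le]) (simp_all add: deg)
      moreover have "coeff d (degree a) = 0" by (simp add: d_def deg)
      ultimately show ?thesis
        using that by (metis leading_coeff_0_iff order_less_le)
    qed
    ultimately have "d = 0" using a by (force simp: is_min_int_poly_def)
    then have eq: "smult (lead_coeff b) a = smult (lead_coeff a) b" by (simp add: d_def)
    from arg_cong[OF this, of content] have "lead_coeff b = lead_coeff a"
      using a b by (simp add: is_min_int_poly_def)
    with eq a0 show "a = b" by (metis leading_coeff_0_iff smult_cancel)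
  qed
  from ex uniq show ?thesis by blast
qed

definition min_int_poly :: "real \<Rightarrow> int poly" where
  "min_int_poly \<alpha> = (THE p. is_min_int_poly \<alpha> p)"

definition alg_degree :: "real \<Rightarrow> nat" where
  "alg_degree \<alpha> = degree (min_int_poly \<alpha>)"

definition alg_height :: "real \<Rightarrow> int" where
  "alg_height \<alpha> = (MAX i\<in>{..degree (min_int_poly \<alpha>)}. \<bar>coeff (min_int_poly \<alpha>) i\<bar>)"


section \<open>Approximation by algebraic numbers\<close>

definition w_exponent :: "nat \<Rightarrow> real \<Rightarrow> ereal" where
  "w_exponent n x = Sup (ereal ` {\<omega>. infinite {\<alpha>. algebraic \<alpha> \<and> alg_degree \<alpha> \<le> n \<and>
     0 < \<bar>x - \<alpha>\<bar> \<and> \<bar>x - \<alpha>\<bar> < real_of_int (alg_height \<alpha>) powr (- \<omega> - 1)}})"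

definition quadratically_very_well_approximable :: "real \<Rightarrow> bool" where
  "quadratically_very_well_approximable x \<longleftrightarrow> w_exponent 2 x > 2"

definition quadratically_Liouville :: "real \<Rightarrow> bool" where
  "quadratically_Liouville x \<longleftrightarrow> w_exponent 2 x = \<infinity>"

end

theory Submission
  imports Defs
begin

text \<open>
  Let \<open>a\<close> and \<open>b\<close> be two elements of \<open>D\<close>. The number \<open>x\<close> is the continued fraction whose
  partial quotients are all \<open>a\<close>, except for a \<open>b\<close> at the lacunary indices \<open>1, L, L\<^sup>2, L\<^sup>3, \<dots>\<close>,
  where \<open>L\<close> is a large integer. (Indices start at \<open>0\<close>.) Changing every \<open>b\<close> after index \<open>L ^ k\<close> into \<open>a\<close> makes the
  expansion eventually constant and gives a quadratic irrational \<open>\<alpha> k\<close>. Each partial quotient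
  in front of the constant tail multiplies the height by a bounded factor, so that
  \<open>H (\<alpha> k) \<le> Q ^ L ^ k\<close> with \<open>Q\<close> depending on the largest element of \<open>D\<close> only; and \<open>x\<close> and
  \<open>\<alpha> k\<close> share their first \<open>L ^ Suc k\<close> partial quotients, so that they are exponentially close
  in \<open>L ^ Suc k\<close>, at a rate that does not depend on \<open>L\<close>. For \<open>L\<close> large this yields
  \<open>\<bar>x - \<alpha> k\<bar> \<le> (Q ^ L ^ k) powr (-5)\<close>, hence \<open>w\<^sub>2(x) \<ge> 3\<close>.

  The bounds \<open>Q ^ L ^ k\<close> grow only by raising to the fixed power \<open>L\<close> from one \<open>k\<close> to the next, and
  this keeps \<open>x\<close> from being quadratically Liouville. Given \<open>\<beta>\<close> of degree at most 2 and height
  \<open>H\<close>, choose \<open>k\<close> least with \<open>Q ^ L ^ k \<ge> 7 * H\<close>. One of \<open>\<alpha> k\<close>, \<open>\<alpha> (Suc k)\<close> differs from \<open>\<beta>\<close>, and its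
  distance to \<open>\<beta>\<close> is bounded below by a negative power of the two heights
  (\<open>Liouville_inequality_quadratic\<close>). That distance exceeds twice the distance from \<open>x\<close> to the same
  \<open>\<alpha> j\<close>, so \<open>x\<close> is at least half as far from \<open>\<beta>\<close>; as \<open>Q ^ L ^ j\<close> is bounded by a power of
  \<open>H\<close> (times a constant), this is a polynomial lower bound for \<open>\<bar>x - \<beta>\<bar>\<close> in \<open>1 / H\<close>
  (\<open>distance_to_quadratic_root\<close>). Since there are finitely many \<open>\<beta>\<close> of bounded height,
  \<open>w\<^sub>2(x)\<close> is finite.
\<close>

section \<open>Values of infinite continued fractions\<close>

text \<open>
  The innermost term is \<open>1\<close> and not \<open>0\<close>, so that every truncation stays in the interval
  \<open>[1 / (M + 1), 1]\<close>, on which the maps \<open>y \<mapsto> 1 / (k + y)\<close> with \<open>1 \<le> k \<le> M\<close> are uniform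
  contractions. For \<open>k = 1\<close> the derivative at \<open>0\<close> has modulus \<open>1\<close>, so \<open>[0, 1]\<close> would not do.
\<close>

primrec cf_trunc :: "nat \<Rightarrow> (nat \<Rightarrow> nat) \<Rightarrow> real" where
  "cf_trunc 0 d = 1"
| "cf_trunc (Suc n) d = 1 / (real (d 0) + cf_trunc n (\<lambda>i. d (Suc i)))"

definition cf_value :: "(nat \<Rightarrow> nat) \<Rightarrow> real" where
  "cf_value d = lim (\<lambda>n. cf_trunc n d)"

lemma quotient_in:
  "range d \<subseteq> {1..M} \<Longrightarrow> d (i :: nat) \<in> {1..(M :: nat)}"
  by (rule subsetD) auto

lemma range_shift:
  "range d \<subseteq> {1..M} \<Longrightarrow> range (\<lambda>i. d (i + k :: nat)) \<subseteq> {1..(M :: nat)}"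
  "range d \<subseteq> {1..M} \<Longrightarrow> range (\<lambda>i. d (Suc i)) \<subseteq> {1..(M :: nat)}"
  by auto

lemma cf_step_bounds:
  fixes y :: real
  assumes "k \<in> {1..M}" and "1 / (real M + 1) \<le> y" "y \<le> 1"
  shows "1 / (real M + 1) \<le> 1 / (real k + y)" and "1 / (real k + y) < 1"
proof -
  have y: "0 < y" using assms(2) by (rule less_le_trans[rotated]) simp
  have k: "1 \<le> real k" "real k \<le> real M" using assms(1) by auto
  show "1 / (real M + 1) \<le> 1 / (real k + y)"
    using y k assms(3) by (intro divide_left_mono mult_pos_pos) auto
  show "1 / (real k + y) < 1" using y k by (simp add: divide_less_eq)
qed

text \<open>
  The difference of the two values is \<open>\<bar>y - z\<bar>\<close> divided by \<open>(k + y) * (k + z)\<close>; one factor of this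
  product is at least \<open>1 + 1 / (M + 1)\<close>, the inverse of the contraction constant, and the other is
  at least \<open>1\<close>.
\<close>

lemma cf_step_contraction:
  fixes y z :: real
  assumes k: "k \<in> {1..M}"
    and y: "1 / (real M + 1) \<le> y" "y \<le> 1" and z: "1 / (real M + 1) \<le> z" "z \<le> 1"
  shows "\<bar>1 / (real k + y) - 1 / (real k + z)\<bar> \<le> (real M + 1) / (real M + 2) * \<bar>y - z\<bar>"
proof -
  define s where "s = 1 / (real M + 1)"
  have s: "0 < s" by (simp add: s_def)
  have k1: "1 \<le> real k" using k by auto
  have ys: "s \<le> y" "s \<le> z" using y z by (auto simp: s_def)
  have "1 / (real k + y) - 1 / (real k + z) = (z - y) / ((real k + y) * (real k + z))"
    using s ys k1 by (simp add: field_simps)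
  then have "\<bar>1 / (real k + y) - 1 / (real k + z)\<bar> = \<bar>y - z\<bar> / ((real k + y) * (real k + z))"
    using s ys k1 by (simp add: abs_mult abs_minus_commute)
  also have "\<dots> \<le> \<bar>y - z\<bar> / ((1 + s) * 1)"
    using s ys k1 by (intro divide_left_mono mult_mono mult_pos_pos) auto
  also have "\<dots> = (real M + 1) / (real M + 2) * \<bar>y - z\<bar>"
    by (simp add: s_def field_simps)
  finally show ?thesis .
qed

lemma cf_trunc_bounds:
  assumes "range d \<subseteq> {1..M}"
  shows "1 / (real M + 1) \<le> cf_trunc n d \<and> cf_trunc n d \<le> 1"
  using assms
proof (induction n arbitrary: d)
  case (Suc n)
  have "1 / (real M + 1) \<le> cf_trunc n (\<lambda>i. d (Suc i)) \<and> cf_trunc n (\<lambda>i. d (Suc i)) \<le> 1"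
    by (intro Suc.IH range_shift Suc.prems)
  with cf_step_bounds[OF quotient_in[OF Suc.prems, of 0]] show ?case by force
qed simp

lemma cf_trunc_Cauchy:
  assumes "range d \<subseteq> {1..M}"
  shows "\<bar>cf_trunc (n + m) d - cf_trunc n d\<bar> \<le> ((real M + 1) / (real M + 2)) ^ n"
  using assms
proof (induction n arbitrary: d)
  case 0
  have "0 \<le> 1 / (real M + 1)" by simp
  then have "0 \<le> cf_trunc m d" using cf_trunc_bounds[OF 0, of m] by linarith
  then show ?case using cf_trunc_bounds[OF 0, of m] by simp
next
  case (Suc n)
  let ?e = "\<lambda>i. d (Suc i)"
  have e: "range ?e \<subseteq> {1..M}" by (rule range_shift(2)) (rule Suc.prems(1))
  have "\<bar>cf_trunc (Suc n + m) d - cf_trunc (Suc n) d\<bar>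
      \<le> (real M + 1) / (real M + 2) * \<bar>cf_trunc (n + m) ?e - cf_trunc n ?e\<bar>"
    using cf_step_contraction[OF quotient_in[OF Suc.prems, of 0]] cf_trunc_bounds[OF e] by simp
  also have "\<dots> \<le> (real M + 1) / (real M + 2) * ((real M + 1) / (real M + 2)) ^ n"
    by (intro mult_left_mono Suc.IH e) auto
  finally show ?case by simp
qed

lemma cf_trunc_tendsto:
  assumes d: "range d \<subseteq> {1..M}"
  shows "(\<lambda>n. cf_trunc n d) \<longlonglongrightarrow> cf_value d"
proof -
  define c where "c = (real M + 1) / (real M + 2)"
  have c: "\<bar>c\<bar> < 1" by (simp add: c_def)
  have "Cauchy (\<lambda>n. cf_trunc n d)"
  proof (rule metric_CauchyI)
    fix \<epsilon> :: real assume "0 < \<epsilon>"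
    then have "0 < \<epsilon> / 2" by simp
    then obtain N where N: "c ^ N < \<epsilon> / 2"
      using real_arch_pow_inv[of "\<epsilon> / 2" c] c by (meson abs_less_iff)
    have *: "\<bar>cf_trunc n d - cf_trunc N d\<bar> < \<epsilon> / 2" if "n \<ge> N" for n
      using cf_trunc_Cauchy[OF d, of N "n - N"] N that by (simp add: c_def)
    show "\<exists>N. \<forall>m\<ge>N. \<forall>n\<ge>N. dist (cf_trunc m d) (cf_trunc n d) < \<epsilon>"
    proof (intro exI[of _ N] allI impI)
      fix m n assume "N \<le> m" "N \<le> n"
      then show "dist (cf_trunc m d) (cf_trunc n d) < \<epsilon>"
        using *[of m] *[of n] unfolding dist_real_def by linarith
    qed
  qed
  then show ?thesis
    unfolding cf_value_def by (simp add: Cauchy_convergent_iff convergent_LIMSEQ_iff)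
qed

lemma cf_value_bounds_weak:
  assumes d: "range d \<subseteq> {1..M}"
  shows "1 / (real M + 1) \<le> cf_value d" "cf_value d \<le> 1"
proof -
  note lim = cf_trunc_tendsto[OF d]
  show "1 / (real M + 1) \<le> cf_value d"
    by (rule LIMSEQ_le_const[OF lim]) (use cf_trunc_bounds[OF d] in auto)
  show "cf_value d \<le> 1"
    by (rule LIMSEQ_le_const2[OF lim]) (use cf_trunc_bounds[OF d] in auto)
qed

lemma cf_value_rec:
  assumes d: "range d \<subseteq> {1..M}"
  shows "cf_value d = 1 / (real (d 0) + cf_value (\<lambda>i. d (Suc i)))"
proof -
  let ?e = "\<lambda>i. d (Suc i)"
  have e: "range ?e \<subseteq> {1..M}" by (rule range_shift(2)) (rule d)
  have "0 < 1 / (real M + 1)" by simp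
  then have pos: "0 < cf_value ?e" using cf_value_bounds_weak(1)[OF e] by linarith
  have "(\<lambda>n. 1 / (real (d 0) + cf_trunc n ?e)) \<longlonglongrightarrow> 1 / (real (d 0) + cf_value ?e)"
    by (intro tendsto_intros cf_trunc_tendsto[OF e]) (use pos in linarith)
  then have "(\<lambda>n. cf_trunc (Suc n) d) \<longlonglongrightarrow> 1 / (real (d 0) + cf_value ?e)" by simp
  moreover have "(\<lambda>n. cf_trunc (Suc n) d) \<longlonglongrightarrow> cf_value d"
    using cf_trunc_tendsto[OF d] by (rule LIMSEQ_Suc)
  ultimately show ?thesis by (rule LIMSEQ_unique[rotated])
qed

lemma cf_value_bounds:
  assumes d: "range d \<subseteq> {1..M}"
  shows "0 < cf_value d" "cf_value d < 1"
proof -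
  have "0 < 1 / (real M + 1)" by simp
  then show "0 < cf_value d" using cf_value_bounds_weak(1)[OF d] by linarith
  have e: "range (\<lambda>i. d (Suc i)) \<subseteq> {1..M}" by (rule range_shift(2)) (rule d)
  show "cf_value d < 1"
    unfolding cf_value_rec[OF d] by (intro cf_step_bounds(2)[OF quotient_in[OF d]] cf_value_bounds_weak[OF e])
qed

text \<open>
  Two expansions with \<open>n\<close> common leading quotients are images of points of the unit interval under
  the same composition of \<open>n\<close> contractions. The rate depends on \<open>M\<close> alone.
\<close>

lemma cf_value_close:
  assumes "range d \<subseteq> {1..M}" "range e \<subseteq> {1..M}" and "\<And>i. i < n \<Longrightarrow> d i = e i"
  shows "\<bar>cf_value d - cf_value e\<bar> \<le> ((real M + 1) / (real M + 2)) ^ n"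
  using assms
proof (induction n arbitrary: d e)
  case 0
  show ?case using cf_value_bounds[OF 0(1)] cf_value_bounds[OF 0(2)] by simp
next
  case (Suc n)
  let ?d = "\<lambda>i. d (Suc i)" and ?e = "\<lambda>i. e (Suc i)"
  have d: "range ?d \<subseteq> {1..M}" and e: "range ?e \<subseteq> {1..M}"
    by (intro range_shift Suc.prems)+
  have eq: "d 0 = e 0" using Suc.prems(3)[of 0] by simp
  have "\<bar>cf_value d - cf_value e\<bar> \<le> (real M + 1) / (real M + 2) * \<bar>cf_value ?d - cf_value ?e\<bar>"
    unfolding cf_value_rec[OF Suc.prems(1)] cf_value_rec[OF Suc.prems(2)] eq
    by (intro cf_step_contraction quotient_in Suc.prems cf_value_bounds_weak[OF d] cf_value_bounds_weak[OF e])
  also have "\<dots> \<le> (real M + 1) / (real M + 2) * ((real M + 1) / (real M + 2)) ^ n"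
    by (intro mult_left_mono Suc.IH d e) (use Suc.prems(3) in auto)
  finally show ?case by simp
qed

lemma inverse_cf_value:
  assumes d: "range d \<subseteq> {1..M}"
  shows "1 / cf_value d = real (d 0) + cf_value (\<lambda>i. d (Suc i))"
    and "\<lfloor>1 / cf_value d\<rfloor> = int (d 0)"
    and "gauss_map (cf_value d) = cf_value (\<lambda>i. d (Suc i))"
proof -
  have e: "range (\<lambda>i. d (Suc i)) \<subseteq> {1..M}" by (rule range_shift(2)) (rule d)
  show *: "1 / cf_value d = real (d 0) + cf_value (\<lambda>i. d (Suc i))"
    unfolding cf_value_rec[OF d] by simp
  show fl: "\<lfloor>1 / cf_value d\<rfloor> = int (d 0)"
    unfolding * using cf_value_bounds[OF e] by (simp add: floor_eq_iff)
  show "gauss_map (cf_value d) = cf_value (\<lambda>i. d (Suc i))"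
    unfolding gauss_map_def frac_def fl by (simp add: *)
qed

lemma partial_quotient_cf_value:
  assumes d: "range d \<subseteq> {1..M}" and "n \<ge> 1"
  shows "partial_quotient (cf_value d) n = d (n - 1)"
proof -
  have "(gauss_map ^^ m) (cf_value d) = cf_value (\<lambda>i. d (i + m))" for m
    by (induction m) (simp_all add: inverse_cf_value(3)[OF range_shift(1)[OF d]])
  then show ?thesis
    unfolding partial_quotient_def
    by (simp add: inverse_cf_value(2)[OF range_shift(1)[OF d]])
qed

lemma cf_value_inject:
  assumes d: "range d \<subseteq> {1..M}" and e: "range e \<subseteq> {1..M}" and eq: "cf_value d = cf_value e"
  shows "d = e"
proof
  fix i
  show "d i = e i"
    using partial_quotient_cf_value[OF d, of "Suc i"] partial_quotient_cf_value[OF e, of "Suc i"] eq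
    by simp
qed

text \<open>
  Descent on the denominator: if the value is \<open>p / q\<close> with \<open>0 < p < q\<close>, then the value of the
  shifted expansion is \<open>q / p - d 0\<close>, a fraction with the smaller denominator \<open>p\<close>.
\<close>

lemma cf_value_irrational:
  assumes "range d \<subseteq> {1..M}"
  shows "cf_value d \<notin> \<rat>"
proof -
  have no_fraction: "cf_value d \<noteq> real p / real q" if "range d \<subseteq> {1..M}" for d p q
    using that
  proof (induction q arbitrary: d p rule: less_induct)
    case (less q)
    let ?e = "\<lambda>i. d (Suc i)"
    have e: "range ?e \<subseteq> {1..M}" by (rule range_shift(2)) (rule less.prems)
    note b = cf_value_bounds[OF less.prems] and be = cf_value_bounds[OF e]
    show ?case
    proof
      assume eq: "cf_value d = real p / real q"
      then have pq: "0 < p" "0 < q" "p < q"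
        using b by (auto simp: zero_less_divide_iff divide_less_eq split: if_splits)
      have "cf_value ?e = real q / real p - real (d 0)"
        using inverse_cf_value(1)[OF less.prems] eq by simp
      then have "real p * cf_value ?e = real q - real (d 0) * real p"
        using pq by (simp add: field_simps)
      moreover have "0 < real p * cf_value ?e" using pq be by simp
      ultimately have "d 0 * p < q"
        by (metis diff_gt_0_iff_gt of_nat_less_iff of_nat_mult)
      then have "cf_value ?e = real (q - d 0 * p) / real p"
        using \<open>real p * cf_value ?e = _\<close> pq by (simp add: field_simps of_nat_diff)
      with less.IH[OF \<open>p < q\<close> e] show False by blast
    qed
  qed
  show ?thesis
  proof
    assume "cf_value d \<in> \<rat>"
    then obtain m n where "\<bar>cf_value d\<bar> = real m / real n" by (rule Rats_abs_nat_div_natE)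
    with no_fraction[OF assms] cf_value_bounds[OF assms] show False by simp
  qed
qed

lemma cf_value_in_cf_set:
  assumes d: "range d \<subseteq> {1..M}" and D: "\<And>i. d i \<in> D"
  shows "cf_value d \<in> cf_set D"
  unfolding cf_set_def
  using cf_value_bounds[OF d] cf_value_irrational[OF d] partial_quotient_cf_value[OF d] D by auto

section \<open>Quadratic equations with integer coefficients\<close>

text \<open>
  A height bound for numbers of degree at most 2 that does not mention the minimal polynomial:
  the polynomial need neither be primitive nor have degree 2.
\<close>

definition int_quadratic_root :: "real \<Rightarrow> real \<Rightarrow> bool" where
  "int_quadratic_root H \<alpha> \<longleftrightarrow>
     (\<exists>(a :: int) (b :: int) (c :: int). (a \<noteq> 0 \<or> b \<noteq> 0 \<or> c \<noteq> 0) \<and>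
        \<bar>a\<bar> \<le> H \<and> \<bar>b\<bar> \<le> H \<and> \<bar>c\<bar> \<le> H \<and> a * \<alpha>\<^sup>2 + b * \<alpha> + c = 0)"

lemma int_quadratic_rootE:
  assumes "int_quadratic_root H \<alpha>"
  obtains a b c :: int where "a \<noteq> 0 \<or> b \<noteq> 0 \<or> c \<noteq> 0"
    "\<bar>real_of_int a\<bar> \<le> H" "\<bar>real_of_int b\<bar> \<le> H" "\<bar>real_of_int c\<bar> \<le> H"
    "real_of_int a * \<alpha>\<^sup>2 + real_of_int b * \<alpha> + real_of_int c = 0"
  using assms unfolding int_quadratic_root_def by auto

lemma int_quadratic_rootI:
  assumes "a \<noteq> 0 \<or> b \<noteq> 0 \<or> c \<noteq> 0"
    "\<bar>real_of_int a\<bar> \<le> H" "\<bar>real_of_int b\<bar> \<le> H" "\<bar>real_of_int c\<bar> \<le> H"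
    "real_of_int a * \<alpha>\<^sup>2 + real_of_int b * \<alpha> + real_of_int c = 0"
  shows "int_quadratic_root H \<alpha>"
  unfolding int_quadratic_root_def using assms by (intro exI[of _ a] exI[of _ b] exI[of _ c]) auto

lemma int_quadratic_root_mono:
  "int_quadratic_root H \<alpha> \<Longrightarrow> H \<le> K \<Longrightarrow> int_quadratic_root K \<alpha>"
  unfolding int_quadratic_root_def by (meson order_trans)

lemma one_le_abs_of_int: "n \<noteq> 0 \<Longrightarrow> 1 \<le> \<bar>real_of_int n\<bar>"
  by (metis of_int_abs of_int_1_le_iff zero_less_abs_iff int_one_le_iff_zero_less)

lemma int_quadratic_root_height_ge_1:
  assumes "int_quadratic_root H \<alpha>" shows "1 \<le> H"
  using assms by (elim int_quadratic_rootE) (meson order_trans one_le_abs_of_int)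

lemma irrational_linear_independent:
  fixes p q :: int and \<beta> :: real
  assumes "\<beta> \<notin> \<rat>" and eq: "real_of_int p * \<beta> + real_of_int q = 0"
  shows "p = 0 \<and> q = 0"
proof -
  have "p = 0"
  proof (rule ccontr)
    assume "p \<noteq> 0"
    then have "\<beta> = - real_of_int q / real_of_int p" using eq by (simp add: field_simps)
    with assms(1) show False by simp
  qed
  with eq show ?thesis by simp
qed

text \<open>
  Let \<open>m\<close> be the value at \<open>\<beta>\<close> of the polynomial \<open>a X\<^sup>2 + b X + c\<close> of \<open>\<alpha>\<close>, and let
  \<open>A X\<^sup>2 + B X + C\<close> be the polynomial of \<open>\<beta>\<close>. If \<open>m = 0\<close>, then \<open>\<alpha>\<close> and \<open>\<beta>\<close> are the two roots of
  one polynomial, and \<open>(a * (\<alpha> - \<beta>))\<^sup>2\<close> is its discriminant, a positive integer. Otherwise reduce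
  modulo the polynomial of \<open>\<beta>\<close> to get \<open>A * m = v * \<beta> + u\<close> with integers \<open>u\<close> and \<open>v\<close>. Multiplied by
  \<open>A\<close> times its conjugate, this number becomes a nonzero integer, so it cannot be small; but
  \<open>\<bar>m\<bar>\<close> is at most \<open>4 * H * \<bar>\<alpha> - \<beta>\<bar>\<close>, because the polynomial vanishes at \<open>\<alpha>\<close>.
\<close>

lemma Liouville_inequality_quadratic:
  fixes \<alpha> \<beta> H Q :: real
  assumes \<alpha>: "int_quadratic_root H \<alpha>" and \<beta>: "int_quadratic_root Q \<beta>"
    and irr: "\<beta> \<notin> \<rat>" and ne: "\<alpha> \<noteq> \<beta>"
    and bd: "\<bar>\<alpha>\<bar> \<le> 2" "0 \<le> \<beta>" "\<beta> \<le> 1"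
  shows "1 \<le> 24 * H\<^sup>2 * Q ^ 3 * \<bar>\<alpha> - \<beta>\<bar>"
proof -
  from \<alpha> obtain a b c where nz: "a \<noteq> 0 \<or> b \<noteq> 0 \<or> c \<noteq> 0"
    and H: "\<bar>real_of_int a\<bar> \<le> H" "\<bar>real_of_int b\<bar> \<le> H" "\<bar>real_of_int c\<bar> \<le> H"
    and root: "real_of_int a * \<alpha>\<^sup>2 + real_of_int b * \<alpha> + real_of_int c = 0"
    by (rule int_quadratic_rootE)
  from \<beta> obtain A B C where NZ: "A \<noteq> 0 \<or> B \<noteq> 0 \<or> C \<noteq> 0"
    and Q: "\<bar>real_of_int A\<bar> \<le> Q" "\<bar>real_of_int B\<bar> \<le> Q" "\<bar>real_of_int C\<bar> \<le> Q"
    and ROOT: "real_of_int A * \<beta>\<^sup>2 + real_of_int B * \<beta> + real_of_int C = 0"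
    by (rule int_quadratic_rootE)
  have H1: "1 \<le> H" and Q1: "1 \<le> Q"
    using \<alpha> \<beta> by (auto intro: int_quadratic_root_height_ge_1)
  have A0: "A \<noteq> 0"
    using irrational_linear_independent[OF irr, of B C] ROOT NZ by auto
  define v where "v = A * b - a * B"
  define u where "u = A * c - a * C"
  define m where "m = a * \<beta>\<^sup>2 + b * \<beta> + c"
  have red: "v * \<beta> + u = A * m"
  proof -
    have "A * m - (v * \<beta> + u) = a * (A * \<beta>\<^sup>2 + B * \<beta> + C)"
      by (simp add: v_def u_def m_def algebra_simps)
    with ROOT show ?thesis by simp
  qed
  have m_diff: "m = (\<beta> - \<alpha>) * (a * (\<alpha> + \<beta>) + b)"
    using root by (simp add: m_def algebra_simps power2_eq_square)
  show ?thesis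
  proof (cases "v = 0 \<and> u = 0")
    case True
    then have m0: "m = 0" using red A0 by simp
    then have sum: "a * (\<alpha> + \<beta>) + b = 0" using m_diff ne by simp
    have a0: "a \<noteq> 0"
      using irrational_linear_independent[OF irr, of b c] m0 nz by (auto simp: m_def)
    have disc: "real_of_int (b\<^sup>2 - 4 * a * c) = (a * (\<alpha> - \<beta>))\<^sup>2"
    proof -
      have b: "b = - a * (\<alpha> + \<beta>)" using sum by simp
      have c: "c = - (a * \<beta>\<^sup>2 + b * \<beta>)" using m0 by (simp add: m_def)
      show ?thesis by (simp add: c) (simp add: b algebra_simps power2_eq_square)
    qed
    moreover have "(a * (\<alpha> - \<beta>))\<^sup>2 > 0" using a0 ne by simp
    ultimately have "1 \<le> real_of_int (b\<^sup>2 - 4 * a * c)"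
      by (metis of_int_0_less_iff of_int_1_le_iff int_one_le_iff_zero_less)
    then have "1\<^sup>2 \<le> (a * (\<alpha> - \<beta>))\<^sup>2" unfolding disc by simp
    then have "1 \<le> \<bar>a * (\<alpha> - \<beta>)\<bar>" unfolding abs_le_square_iff[symmetric] by simp
    also have "\<dots> \<le> H * \<bar>\<alpha> - \<beta>\<bar>" using H(1) by (simp add: abs_mult mult_right_mono)
    also have "\<dots> \<le> 24 * H\<^sup>2 * Q ^ 3 * \<bar>\<alpha> - \<beta>\<bar>"
    proof (rule mult_right_mono)
      have "H * 1 \<le> (24 * H\<^sup>2) * Q ^ 3"
        using H1 Q1 by (intro mult_mono) (auto simp: power2_eq_square)
      then show "H \<le> 24 * H\<^sup>2 * Q ^ 3" by simp
    qed simp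
    finally show ?thesis .
  next
    case False
    \<comment> \<open>The conjugate of \<open>\<beta>\<close> is \<open>- B / A - \<beta>\<close>, so \<open>w\<close> is \<open>A\<close> times the conjugate of \<open>v * \<beta> + u\<close>.\<close>
    define w where "w = u * A - v * (B + A * \<beta>)"
    have w0: "w \<noteq> 0"
    proof
      assume "w = 0"
      then have "real_of_int (v * A) * \<beta> + real_of_int (v * B - u * A) = 0"
        by (simp add: w_def algebra_simps)
      from irrational_linear_independent[OF irr this] A0 False show False by auto
    qed
    have vu0: "v * \<beta> + u \<noteq> 0"
      using irrational_linear_independent[OF irr, of v u] False by auto
    have norm: "(v * \<beta> + u) * w = real_of_int (v\<^sup>2 * C - u * v * B + A * u\<^sup>2)"
    proof -
      have "(v * \<beta> + u) * w - (v\<^sup>2 * C - u * v * B + A * u\<^sup>2)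
          = - v\<^sup>2 * (A * \<beta>\<^sup>2 + B * \<beta> + C)"
        by (simp add: w_def algebra_simps power2_eq_square)
      with ROOT show ?thesis by simp
    qed
    have "(v * \<beta> + u) * w \<noteq> 0" using w0 vu0 by simp
    then have "v\<^sup>2 * C - u * v * B + A * u\<^sup>2 \<noteq> 0" unfolding norm by (metis of_int_0)
    then have "1 \<le> \<bar>(v * \<beta> + u) * w\<bar>" unfolding norm by (rule one_le_abs_of_int)
    also have "\<dots> = \<bar>real_of_int A\<bar> * \<bar>m\<bar> * \<bar>w\<bar>" by (simp add: red abs_mult)
    also have "\<dots> \<le> Q * (4 * H * \<bar>\<alpha> - \<beta>\<bar>) * (6 * H * Q\<^sup>2)"
    proof (intro mult_mono)
      have "\<bar>a * (\<alpha> + \<beta>) + b\<bar> \<le> H * 3 + H"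
        using H bd by (intro order_trans[OF abs_triangle_ineq] add_mono)
          (auto simp: abs_mult intro!: mult_mono)
      then have "\<bar>\<beta> - \<alpha>\<bar> * \<bar>a * (\<alpha> + \<beta>) + b\<bar> \<le> \<bar>\<beta> - \<alpha>\<bar> * (4 * H)"
        by (intro mult_left_mono) auto
      then show "\<bar>m\<bar> \<le> 4 * H * \<bar>\<alpha> - \<beta>\<bar>"
        by (simp add: m_diff abs_mult abs_minus_commute mult.commute)
      have prods: "\<bar>real_of_int s * real_of_int t\<bar> \<le> H * Q"
        if "\<bar>real_of_int s\<bar> \<le> H" "\<bar>real_of_int t\<bar> \<le> Q" for s t
        using that H1 by (auto simp: abs_mult intro!: mult_mono)
      have v: "\<bar>real_of_int v\<bar> \<le> 2 * (H * Q)"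
        using prods[OF H(2) Q(1)] prods[OF H(1) Q(2)] by (simp add: v_def mult.commute)
      have u: "\<bar>real_of_int u\<bar> \<le> 2 * (H * Q)"
        using prods[OF H(3) Q(1)] prods[OF H(1) Q(3)] by (simp add: u_def mult.commute)
      have "\<bar>A * \<beta>\<bar> \<le> Q * 1" using Q bd by (simp only: abs_mult) (intro mult_mono, auto)
      then have "\<bar>B + A * \<beta>\<bar> \<le> 2 * Q" using Q by linarith
      then have "\<bar>v * (B + A * \<beta>)\<bar> \<le> 2 * (H * Q) * (2 * Q)"
        using v Q1 H1 by (simp only: abs_mult) (intro mult_mono, auto)
      moreover have "\<bar>real_of_int u * A\<bar> \<le> 2 * (H * Q) * Q"
        using u Q Q1 H1 by (simp only: abs_mult) (intro mult_mono, auto)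
      ultimately have "\<bar>w\<bar> \<le> 2 * (H * Q) * Q + 2 * (H * Q) * (2 * Q)"
        unfolding w_def of_int_mult by linarith
      then show "\<bar>w\<bar> \<le> 6 * H * Q\<^sup>2" by (simp add: power2_eq_square algebra_simps)
    qed (use Q Q1 H1 in auto)
    also have "\<dots> = 24 * H\<^sup>2 * Q ^ 3 * \<bar>\<alpha> - \<beta>\<bar>"
      by (simp add: power2_eq_square power3_eq_cube)
    finally show ?thesis .
  qed
qed

text \<open>
  The constant expansion \<open>y\<close> satisfies \<open>y\<^sup>2 + a * y - 1 = 0\<close>. Prefixing a quotient \<open>k\<close> replaces the
  root \<open>y\<close> by \<open>z = 1 / (k + y)\<close>; substituting \<open>y = 1 / z - k\<close> and clearing denominators gives
  a polynomial whose coefficients have grown by a factor of at most \<open>(k + 1)\<^sup>2\<close>.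
\<close>

lemma cf_value_eventually_constant_root:
  assumes "range d \<subseteq> {1..M}" and "\<And>i. n \<le> i \<Longrightarrow> d i = a"
  shows "int_quadratic_root ((real M + 1) ^ (2 * n + 1)) (cf_value d)"
  using assms
proof (induction n arbitrary: d)
  case 0
  define y where "y = cf_value d"
  have a: "1 \<le> a" "a \<le> M" using quotient_in[OF 0(1), of 0] 0(2)[of 0] by auto
  have da: "d = (\<lambda>i. a)" using 0(2) by auto
  have y: "0 < y" using cf_value_bounds(1)[OF 0(1)] by (simp add: y_def)
  have "y = 1 / (real a + y)" using cf_value_rec[OF 0(1)] by (simp add: y_def da)
  then have "y\<^sup>2 + real a * y - 1 = 0" using y by (simp add: field_simps power2_eq_square)
  then have "int_quadratic_root (real M + 1) y"
    by (intro int_quadratic_rootI[of 1 "int a" "-1"]) (use a in auto)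
  then show ?case by (simp add: y_def)
next
  case (Suc n)
  let ?e = "\<lambda>i. d (Suc i)"
  define K where "K = (real M + 1) ^ (2 * n + 1)"
  define y where "y = cf_value ?e"
  define z where "z = cf_value d"
  define k where "k = d 0"
  have k: "1 \<le> k" "k \<le> M" using quotient_in[OF Suc.prems(1), of 0] by (auto simp: k_def)
  have e: "range ?e \<subseteq> {1..M}" by (rule range_shift(2)) (rule Suc.prems(1))
  have z: "0 < z" using cf_value_bounds(1)[OF Suc.prems(1)] by (simp add: z_def)
  have "1 / z = real k + y"
    using inverse_cf_value(1)[OF Suc.prems(1)] by (simp add: z_def k_def y_def)
  then have y: "y = 1 / z - real k" by simp
  have "int_quadratic_root K (cf_value ?e)"
    unfolding K_def by (rule Suc.IH[OF e]) (simp add: Suc.prems)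
  then obtain A B C where nz: "A \<noteq> 0 \<or> B \<noteq> 0 \<or> C \<noteq> 0"
    and K: "\<bar>real_of_int A\<bar> \<le> K" "\<bar>real_of_int B\<bar> \<le> K" "\<bar>real_of_int C\<bar> \<le> K"
    and root: "real_of_int A * y\<^sup>2 + real_of_int B * y + real_of_int C = 0"
    unfolding y_def by (rule int_quadratic_rootE)
  have K0: "0 \<le> K" using K(1) by linarith
  define A' where "A' = A * (int k)\<^sup>2 - B * int k + C"
  define B' where "B' = B - 2 * A * int k"
  have "z\<^sup>2 * (real_of_int A * y\<^sup>2 + real_of_int B * y + real_of_int C)
      = real_of_int A' * z\<^sup>2 + real_of_int B' * z + real_of_int A"
    using z unfolding y A'_def B'_def by (simp add: field_simps power2_eq_square)
  then have root': "real_of_int A' * z\<^sup>2 + real_of_int B' * z + real_of_int A = 0"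
    using root by simp
  have nz': "A' \<noteq> 0 \<or> B' \<noteq> 0 \<or> A \<noteq> 0" using nz by (auto simp: A'_def B'_def)
  have Ak2: "\<bar>real_of_int A * (real k)\<^sup>2\<bar> \<le> K * (real k)\<^sup>2"
    and Bk: "\<bar>real_of_int B * real k\<bar> \<le> K * real k"
    and Ak: "\<bar>real_of_int A * real k\<bar> \<le> K * real k"
    using K by (simp_all add: abs_mult mult_right_mono)
  have K': "K * (real k + 1)\<^sup>2 \<le> (real M + 1) ^ (2 * Suc n + 1)"
  proof -
    have "K * (real k + 1)\<^sup>2 \<le> K * (real M + 1)\<^sup>2"
      using k K0 by (intro mult_left_mono power_mono) auto
    also have "\<dots> = (real M + 1) ^ (2 * Suc n + 1)"
      unfolding K_def by (subst power_add[symmetric]) simp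
    finally show ?thesis .
  qed
  have ex: "K * (real k + 1)\<^sup>2 = K * (real k)\<^sup>2 + 2 * (K * real k) + K"
    by (simp add: power2_eq_square algebra_simps)
  have Kk: "0 \<le> K * real k" "0 \<le> K * (real k)\<^sup>2" using K0 by auto
  have "int_quadratic_root (K * (real k + 1)\<^sup>2) z"
  proof (rule int_quadratic_rootI[OF nz' _ _ _ root'])
    show "\<bar>real_of_int A'\<bar> \<le> K * (real k + 1)\<^sup>2"
      unfolding ex A'_def using Ak2 Bk K(3) Kk by simp
    show "\<bar>real_of_int B'\<bar> \<le> K * (real k + 1)\<^sup>2"
      proof -
      have "real_of_int B' = B - 2 * (A * real k)" by (simp add: B'_def)
      with ex Ak K0 K(2) Kk show ?thesis by linarith
    qed
    show "\<bar>real_of_int A\<bar> \<le> K * (real k + 1)\<^sup>2"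
      unfolding ex using K(1) Kk by linarith
  qed
  then show ?case unfolding z_def using K' by (rule int_quadratic_root_mono)
qed

section \<open>Degree and height\<close>

lemma poly_of_int_degree_le_2:
  fixes p :: "int poly"
  assumes "degree p \<le> 2"
  shows "poly (map_poly of_int p) (\<alpha> :: real)
      = real_of_int (coeff p 2) * \<alpha>\<^sup>2 + real_of_int (coeff p 1) * \<alpha> + real_of_int (coeff p 0)"
proof -
  have "poly (map_poly of_int p) \<alpha> = (\<Sum>i\<le>2. real_of_int (coeff p i) * \<alpha> ^ i)"
    by (subst poly_altdef, rule sum.mono_neutral_cong_left)
       (use assms in \<open>auto simp: degree_map_poly coeff_map_poly coeff_eq_0\<close>)
  then show ?thesis by (simp add: numeral_2_eq_2)
qed

lemma min_int_poly_props:
  assumes "algebraic \<alpha>"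
  shows "is_min_int_poly \<alpha> (min_int_poly \<alpha>)"
  unfolding min_int_poly_def by (rule theI'[OF is_min_int_poly_ex1[OF assms]])

lemma coeff_min_int_poly_le_height:
  "\<bar>coeff (min_int_poly \<alpha>) i\<bar> \<le> alg_height \<alpha>"
proof (cases "i \<le> degree (min_int_poly \<alpha>)")
  case True
  then show ?thesis unfolding alg_height_def by (intro Max_ge) auto
next
  case False
  have "0 \<le> \<bar>coeff (min_int_poly \<alpha>) 0\<bar>" by simp
  also have "\<dots> \<le> alg_height \<alpha>" unfolding alg_height_def by (intro Max_ge) auto
  finally show ?thesis using False by (simp add: coeff_eq_0)
qed

lemma int_quadratic_root_alg_height:
  assumes "algebraic \<alpha>" and "alg_degree \<alpha> \<le> 2"
  shows "int_quadratic_root (alg_height \<alpha>) \<alpha>"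
proof -
  define p where "p = min_int_poly \<alpha>"
  have p: "is_min_int_poly \<alpha> p" and deg: "degree p \<le> 2"
    using min_int_poly_props assms by (auto simp: p_def alg_degree_def)
  have h: "\<bar>real_of_int (coeff p i)\<bar> \<le> alg_height \<alpha>" for i
    using coeff_min_int_poly_le_height[of \<alpha> i] by (simp add: p_def flip: of_int_abs)
  have "coeff p (degree p) \<noteq> 0" using p by (auto simp: is_min_int_poly_def)
  moreover have "degree p = 0 \<or> degree p = 1 \<or> degree p = 2" using deg by linarith
  ultimately have "coeff p 2 \<noteq> 0 \<or> coeff p 1 \<noteq> 0 \<or> coeff p 0 \<noteq> 0" by metis
  then show ?thesis
    using h p poly_of_int_degree_le_2[OF deg, of \<alpha>]
    by (intro int_quadratic_rootI) (auto simp: is_min_int_poly_def)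
qed

text \<open>
  As \<open>\<alpha>\<close> is irrational, its minimal polynomial has degree 2 and hence is proportional to any
  nonzero integer quadratic vanishing at \<open>\<alpha>\<close>. Being primitive, it divides that quadratic with an
  integer quotient, so its coefficients are no larger.
\<close>

lemma irrational_int_quadratic_root:
  fixes H \<alpha> :: real
  assumes "int_quadratic_root H \<alpha>" and irr: "\<alpha> \<notin> \<rat>"
  shows "algebraic \<alpha>" "alg_degree \<alpha> \<le> 2" "alg_height \<alpha> \<le> H"
proof -
  from assms(1) obtain a b c where nz: "a \<noteq> 0 \<or> b \<noteq> 0 \<or> c \<noteq> 0"
    and H: "\<bar>real_of_int a\<bar> \<le> H" "\<bar>real_of_int b\<bar> \<le> H" "\<bar>real_of_int c\<bar> \<le> H"
    and root: "real_of_int a * \<alpha>\<^sup>2 + real_of_int b * \<alpha> + real_of_int c = 0"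
    by (rule int_quadratic_rootE)
  define P where "P = [:c, b, a:]"
  have a0: "a \<noteq> 0"
    using irrational_linear_independent[OF irr, of b c] root nz by auto
  have degP: "degree P = 2" using a0 by (simp add: P_def)
  have P0: "P \<noteq> 0" using a0 by (simp add: P_def)
  have zP: "poly (map_poly of_int P) \<alpha> = 0"
    using root poly_of_int_degree_le_2[of P \<alpha>] degP
    by (simp add: P_def numeral_2_eq_2)
  have "algebraic \<alpha>"
    by (rule algebraicI[of "map_poly of_int P"])
       (use zP P0 in \<open>auto simp: coeff_map_poly poly_eq_iff\<close>)
  then show "algebraic \<alpha>" .
  define m where "m = min_int_poly \<alpha>"
  have m: "is_min_int_poly \<alpha> m" unfolding m_def by (rule min_int_poly_props) fact
  then have min: "degree m \<le> degree q" if "q \<noteq> 0" "poly (map_poly of_int q) \<alpha> = 0" for q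
    using that by (auto simp: is_min_int_poly_def)
  have deg2: "degree m \<le> 2" using min[OF P0 zP] degP by simp
  then show "alg_degree \<alpha> \<le> 2" by (simp add: alg_degree_def m_def)
  have rootm: "real_of_int (coeff m 2) * \<alpha>\<^sup>2 + real_of_int (coeff m 1) * \<alpha>
      + real_of_int (coeff m 0) = 0"
    using m poly_of_int_degree_le_2[OF deg2, of \<alpha>] by (simp add: is_min_int_poly_def)
  define l where "l = coeff m 2"
  \<comment> \<open>Eliminating the square term leaves a linear relation for the irrational \<open>\<alpha>\<close>.\<close>
  have "real_of_int (l * b - a * coeff m 1) * \<alpha> + real_of_int (l * c - a * coeff m 0) = 0"
  proof -
    have "real_of_int (l * b - a * coeff m 1) * \<alpha> + real_of_int (l * c - a * coeff m 0)
       = l * (a * \<alpha>\<^sup>2 + b * \<alpha> + c) - a * (l * \<alpha>\<^sup>2 + coeff m 1 * \<alpha> + coeff m 0)"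
      by (simp add: algebra_simps)
    with root rootm show ?thesis by (simp add: l_def)
  qed
  from irrational_linear_independent[OF irr this]
  have lin: "l * b = a * coeff m 1" "l * c = a * coeff m 0" by auto
  have "m = [:coeff m 0, coeff m 1, l:]"
    using deg2 by (intro poly_eqI)
      (auto simp: l_def coeff_pCons numeral_2_eq_2 split: nat.splits intro: coeff_eq_0)
  then have proportional: "smult l P = smult a m"
    using lin by (metis P_def smult_pCons smult_0_right mult.commute)
  then have "\<bar>l\<bar> * content P = \<bar>a\<bar>"
    using m by (metis content_smult is_min_int_poly_def mult.right_neutral normalize_int_def)
  then have dvd: "l dvd a" by (metis abs_dvd_iff dvd_abs_iff dvd_triv_left)
  then obtain t where t: "a = l * t" by (elim dvdE)
  have l0: "l \<noteq> 0" and t0: "t \<noteq> 0" using t a0 by auto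
  have "coeff P i = t * coeff m i" for i
  proof -
    have "l * coeff P i = l * (t * coeff m i)"
      using arg_cong[OF proportional, of "\<lambda>p. coeff p i"] by (simp add: t)
    with l0 show ?thesis by simp
  qed
  then have "\<bar>coeff m i\<bar> \<le> \<bar>coeff P i\<bar>" for i
    using t0 mult_right_mono[of 1 "\<bar>t\<bar>" "\<bar>coeff m i\<bar>"] by (simp add: abs_mult)
  moreover have "\<bar>real_of_int (coeff P i)\<bar> \<le> H" for i
  proof -
    have "0 \<le> H" using H(1) by linarith
    then show ?thesis using H by (auto simp: P_def coeff_pCons split: nat.splits)
  qed
  ultimately have bd: "real_of_int \<bar>coeff m i\<bar> \<le> H" for i
    by (metis of_int_abs of_int_le_iff order_trans)
  have "alg_height \<alpha> \<in> (\<lambda>i. \<bar>coeff m i\<bar>) ` {..degree m}"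
    unfolding alg_height_def m_def by (intro Max_in) auto
  then show "alg_height \<alpha> \<le> H" using bd by auto
qed

lemma finite_int_quadratic_root: "finite {\<alpha>. int_quadratic_root H \<alpha>}"
proof (rule finite_subset)
  let ?I = "{-\<lfloor>H\<rfloor>..\<lfloor>H\<rfloor>}"
  let ?S = "(?I \<times> ?I \<times> ?I) - {(0, 0, 0)}"
  let ?R = "\<lambda>(a, b, c). {\<alpha> :: real. poly [:real_of_int c, of_int b, of_int a:] \<alpha> = 0}"
  have int: "n \<in> ?I" if "\<bar>real_of_int n\<bar> \<le> H" for n
    using that by (auto simp: le_floor_iff minus_le_iff)
  show "{\<alpha>. int_quadratic_root H \<alpha>} \<subseteq> (\<Union>s\<in>?S. ?R s)"
  proof
    fix \<alpha> assume "\<alpha> \<in> {\<alpha>. int_quadratic_root H \<alpha>}"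
    then have "int_quadratic_root H \<alpha>" by simp
    then obtain a b c where "a \<noteq> 0 \<or> b \<noteq> 0 \<or> c \<noteq> 0"
      and "\<bar>real_of_int a\<bar> \<le> H" "\<bar>real_of_int b\<bar> \<le> H" "\<bar>real_of_int c\<bar> \<le> H"
      and root: "real_of_int a * \<alpha>\<^sup>2 + real_of_int b * \<alpha> + real_of_int c = 0"
      by (rule int_quadratic_rootE)
    then have "(a, b, c) \<in> ?S" using int by auto
    moreover have "\<alpha> \<in> ?R (a, b, c)"
      using root by (simp add: algebra_simps power2_eq_square)
    ultimately show "\<alpha> \<in> (\<Union>s\<in>?S. ?R s)" by blast
  qed
  show "finite (\<Union>s\<in>?S. ?R s)"
  proof (rule finite_UN_I)
    fix s assume "s \<in> ?S"
    then obtain a b c where s: "s = (a, b, c)" and nz: "(a, b, c) \<noteq> (0, 0, 0)"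
      by (cases s) auto
    from nz have "[:real_of_int c, of_int b, of_int a:] \<noteq> 0" by auto
    then show "finite (?R s)" unfolding s prod.case by (rule poly_roots_finite)
  qed simp
qed

section \<open>Numbers with a geometric sequence of good quadratic approximations\<close>

text \<open>
  The exponent \<open>5\<close> leaves room for both estimates: it exceeds \<open>4 = 3 + 1\<close>, which gives
  \<open>w\<^sub>2(x) \<ge> 3\<close>, and the exponent \<open>3\<close> of \<open>Q\<close> in \<open>Liouville_inequality_quadratic\<close> by \<open>2\<close>, which
  makes the distance from \<open>x\<close> to \<open>\<alpha> k\<close> negligible as soon as \<open>Q ^ L ^ k\<close> is a little larger than
  the height of the number to be compared with \<open>x\<close>.
\<close>

locale quadratic_approximations =
  fixes x :: real and \<alpha> :: "nat \<Rightarrow> real" and Q :: real and L :: nat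
  assumes x: "0 < x" "x < 1"
    and Q: "2 \<le> Q" and L: "2 \<le> L"
    and inj: "inj \<alpha>"
    and \<alpha>_irrational: "\<alpha> k \<notin> \<rat>"
    and \<alpha>_bounds: "0 < \<alpha> k" "\<alpha> k < 1"
    and \<alpha>_root: "int_quadratic_root (Q ^ L ^ k) (\<alpha> k)"
    and \<alpha>_close: "\<bar>x - \<alpha> k\<bar> * (Q ^ L ^ k) ^ 5 \<le> 1"
begin

lemma heights_unbounded: "\<exists>k. K \<le> Q ^ L ^ k"
proof -
  obtain n where n: "K < Q ^ n" using real_arch_pow[of Q K] Q by auto
  have "n \<le> L ^ n" using L by (intro less_imp_le power_gt_expt) auto
  then have "Q ^ n \<le> Q ^ L ^ n" by (rule power_increasing) (use Q in simp)
  with n show ?thesis by (intro exI[of _ n]) linarith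
qed

text \<open>
  The number \<open>\<beta>\<close> may be rational, one of the \<open>\<alpha> k\<close>, or \<open>x\<close> itself; the last case is thereby
  excluded. Two consecutive indices are considered because \<open>\<beta>\<close> may coincide with one \<open>\<alpha> k\<close>; moving
  on to the next index only raises the height bound to the power \<open>L\<close>.
\<close>

lemma distance_to_quadratic_root:
  assumes \<beta>: "int_quadratic_root H \<beta>"
  shows "1 \<le> 48 * H\<^sup>2 * (7 * Q * H) ^ (3 * L\<^sup>2) * \<bar>x - \<beta>\<bar>"
proof -
  have H1: "1 \<le> H" using \<beta> by (rule int_quadratic_root_height_ge_1)
  have "1 * 1 \<le> (7 * Q) * H" using Q H1 by (intro mult_mono) auto
  then have G1: "1 \<le> 7 * Q * H" by simp
  show ?thesis
  proof (cases "\<bar>\<beta>\<bar> \<le> 2")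
    case False
    then have "1 \<le> \<bar>x - \<beta>\<bar>" using x by linarith
    moreover have "1 \<le> H\<^sup>2" using H1 by (rule one_le_power)
    moreover have "1 \<le> (7 * Q * H) ^ (3 * L\<^sup>2)" using G1 by (rule one_le_power)
    ultimately have "1 * 1 * 1 \<le> (48 * H\<^sup>2) * (7 * Q * H) ^ (3 * L\<^sup>2) * \<bar>x - \<beta>\<bar>"
      by (intro mult_mono) auto
    then show ?thesis by simp
  next
    case True
    \<comment> \<open>The factor \<open>7\<close> is chosen so that \<open>7\<^sup>2 \<ge> 2 * 24\<close>, with the constant \<open>24\<close> of the
      Liouville inequality: the error \<open>\<bar>x - \<alpha> j\<bar>\<close> then uses up at most half of it.\<close>
    define k where "k = (LEAST k. 7 * H \<le> Q ^ L ^ k)"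
    have k: "7 * H \<le> Q ^ L ^ k"
      unfolding k_def using heights_unbounded by (rule LeastI_ex)
    have k_upper: "Q ^ L ^ k \<le> (7 * Q * H) ^ L"
    proof (cases k)
      case 0
      have "Q * 1 \<le> (7 * Q) * H" using Q H1 by (intro mult_mono) auto
      also have "7 * Q * H \<le> (7 * Q * H) ^ L" using G1 L by (intro self_le_power) auto
      finally show ?thesis using 0 by simp
    next
      case (Suc j)
      have "Q ^ L ^ j \<le> 7 * H"
        using not_less_Least[of j "\<lambda>k. 7 * H \<le> Q ^ L ^ k"] Suc by (simp add: k_def)
      also have "\<dots> \<le> 7 * Q * H" using Q H1 by simp
      finally have "(Q ^ L ^ j) ^ L \<le> (7 * Q * H) ^ L" using Q by (intro power_mono) auto
      then show ?thesis by (simp add: Suc power_mult[symmetric] mult.commute)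
    qed
    have "\<alpha> k \<noteq> \<alpha> (Suc k)" using inj by (auto dest: injD)
    then obtain j where j: "j = k \<or> j = Suc k" and ne: "\<beta> \<noteq> \<alpha> j" by metis
    define R where "R = Q ^ L ^ j"
    have "L ^ k \<le> L ^ j" using j L by (intro power_increasing) auto
    then have "Q ^ L ^ k \<le> R" unfolding R_def by (rule power_increasing) (use Q in simp)
    with k have R: "7 * H \<le> R" by linarith
    have R_upper: "R \<le> (7 * Q * H) ^ L\<^sup>2"
    proof -
      have "L ^ j \<le> L ^ Suc k" using j L by (intro power_increasing) auto
      then have "R \<le> Q ^ L ^ Suc k" unfolding R_def by (rule power_increasing) (use Q in simp)
      also have "\<dots> = (Q ^ L ^ k) ^ L" by (simp add: power_mult[symmetric] mult.commute)
      also have "\<dots> \<le> ((7 * Q * H) ^ L) ^ L" using k_upper Q by (intro power_mono) auto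
      also have "\<dots> = (7 * Q * H) ^ L\<^sup>2" by (simp add: power_mult[symmetric] power2_eq_square)
      finally show ?thesis .
    qed
    have R0: "0 < R" using R H1 by linarith
    have "1 \<le> 24 * H\<^sup>2 * R ^ 3 * \<bar>\<beta> - \<alpha> j\<bar>"
      unfolding R_def
      by (rule Liouville_inequality_quadratic[OF \<beta> \<alpha>_root \<alpha>_irrational ne True])
         (use \<alpha>_bounds[of j] in auto)
    also have "\<dots> \<le> 24 * H\<^sup>2 * R ^ 3 * (\<bar>x - \<beta>\<bar> + \<bar>x - \<alpha> j\<bar>)"
      using R0 by (intro mult_left_mono) auto
    also have "\<dots> = 24 * H\<^sup>2 * R ^ 3 * \<bar>x - \<beta>\<bar> + 24 * H\<^sup>2 * R ^ 3 * \<bar>x - \<alpha> j\<bar>"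
      by (simp add: distrib_left)
    also have "24 * H\<^sup>2 * R ^ 3 * \<bar>x - \<alpha> j\<bar> \<le> 1 / 2"
    proof -
      have "(7 * H)\<^sup>2 \<le> R\<^sup>2" using R H1 by (intro power_mono) auto
      then have "49 * H\<^sup>2 \<le> R\<^sup>2" by (simp add: power_mult_distrib)
      then have "48 * H\<^sup>2 \<le> R\<^sup>2" using zero_le_power2[of H] by linarith
      then have "48 * H\<^sup>2 * (R ^ 3 * \<bar>x - \<alpha> j\<bar>) \<le> R\<^sup>2 * (R ^ 3 * \<bar>x - \<alpha> j\<bar>)"
        using R0 by (intro mult_right_mono) auto
      also have "\<dots> = \<bar>x - \<alpha> j\<bar> * (Q ^ L ^ j) ^ 5"
        by (simp add: R_def[symmetric] eval_nat_numeral)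
      also have "\<dots> \<le> 1" by (rule \<alpha>_close)
      finally show ?thesis by simp
    qed
    finally have "1 \<le> 48 * H\<^sup>2 * R ^ 3 * \<bar>x - \<beta>\<bar>" by simp
    also have "\<dots> \<le> 48 * H\<^sup>2 * ((7 * Q * H) ^ L\<^sup>2) ^ 3 * \<bar>x - \<beta>\<bar>"
      using R_upper R0 by (intro mult_left_mono mult_right_mono power_mono) auto
    also have "((7 * Q * H) ^ L\<^sup>2) ^ 3 = (7 * Q * H) ^ (3 * L\<^sup>2)"
      by (simp add: power_mult[symmetric] mult.commute)
    finally show ?thesis .
  qed
qed

lemma not_int_quadratic_root: "\<not> int_quadratic_root H x"
  using distance_to_quadratic_root[of H x] by auto

lemma very_well_approximable: "quadratically_very_well_approximable x"
proof -
  let ?S = "{\<beta>. algebraic \<beta> \<and> alg_degree \<beta> \<le> 2 \<and> 0 < \<bar>x - \<beta>\<bar> \<and>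
      \<bar>x - \<beta>\<bar> < real_of_int (alg_height \<beta>) powr (- 3 - 1)}"
  have "\<alpha> k \<in> ?S" for k
  proof -
    note alg = irrational_int_quadratic_root[OF \<alpha>_root \<alpha>_irrational, of k]
    define R where "R = Q ^ L ^ k"
    define h where "h = real_of_int (alg_height (\<alpha> k))"
    have "0 < L ^ k" using L by simp
    then have R1: "1 < R" using Q unfolding R_def by (intro one_less_power) auto
    have h: "1 \<le> h" "h \<le> R"
      using alg int_quadratic_root_height_ge_1[OF int_quadratic_root_alg_height, of "\<alpha> k"]
      by (auto simp: h_def R_def)
    have "x \<noteq> \<alpha> k" using \<alpha>_root[of k] not_int_quadratic_root by metis
    moreover have "\<bar>x - \<alpha> k\<bar> < h powr (- 3 - 1)"
    proof -
      have "\<bar>x - \<alpha> k\<bar> \<le> 1 / R ^ 5" using \<alpha>_close[of k] R1 by (simp add: R_def field_simps)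
      also have "\<dots> < 1 / R ^ 4"
        using R1 by (intro divide_strict_left_mono power_strict_increasing) auto
      also have "\<dots> \<le> 1 / h ^ 4" using h by (intro divide_left_mono power_mono) auto
      also have "\<dots> = h powr (- 3 - 1)"
        using h powr_realpow[of h 4] by (simp add: powr_minus_divide)
      finally show ?thesis .
    qed
    ultimately show ?thesis using alg by (simp add: h_def)
  qed
  then have "range \<alpha> \<subseteq> ?S" by blast
  moreover have "infinite (range \<alpha>)" using inj by (rule range_inj_infinite)
  ultimately have "infinite ?S" by (rule infinite_super)
  then have "ereal 3 \<le> w_exponent 2 x" unfolding w_exponent_def by (intro Sup_upper imageI) simp
  moreover have "(2 :: ereal) < ereal 3" by (simp add: numeral_eq_ereal)
  ultimately show ?thesis unfolding quadratically_very_well_approximable_def by order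
qed

text \<open>
  A number of height at least \<open>336 * Q\<close>, where \<open>336 = 48 * 7\<close>, absorbs the constants of
  \<open>distance_to_quadratic_root\<close> at the price of doubling the exponent \<open>2 + 3 * L\<^sup>2\<close>. Hence for
  \<open>\<omega> > W\<close> every approximation has height at most \<open>336 * Q\<close>, and there are finitely many of them.
\<close>

lemma not_Liouville: "\<not> quadratically_Liouville x"
proof -
  define W where "W = 2 * (2 + 3 * L\<^sup>2)"
  define K where "K = 336 * Q"
  have "\<omega> \<le> real W" if inf: "infinite {\<beta>. algebraic \<beta> \<and> alg_degree \<beta> \<le> 2 \<and>
      0 < \<bar>x - \<beta>\<bar> \<and> \<bar>x - \<beta>\<bar> < real_of_int (alg_height \<beta>) powr (- \<omega> - 1)}" (is "infinite ?S") for \<omega>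
  proof (rule ccontr)
    assume \<omega>: "\<not> \<omega> \<le> real W"
    have "?S \<subseteq> {\<beta>. int_quadratic_root K \<beta>}"
    proof
      fix \<beta> assume "\<beta> \<in> ?S"
      then have alg: "algebraic \<beta>" "alg_degree \<beta> \<le> 2"
        and close: "\<bar>x - \<beta>\<bar> < real_of_int (alg_height \<beta>) powr (- \<omega> - 1)" by auto
      define h where "h = real_of_int (alg_height \<beta>)"
      have root: "int_quadratic_root h \<beta>"
        unfolding h_def using alg by (rule int_quadratic_root_alg_height)
      have h1: "1 \<le> h" using root by (rule int_quadratic_root_height_ge_1)
      have "h \<le> K"
      proof (rule ccontr)
        assume "\<not> h \<le> K"
        then have hK: "K \<le> h" by simp
        have g: "1 \<le> h * K" "48 * h\<^sup>2 \<le> (h * K)\<^sup>2" "7 * Q * h \<le> h * K"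
        proof -
          have "1 * 1 \<le> h * K" using h1 Q by (intro mult_mono) (auto simp: K_def)
          then show "1 \<le> h * K" by simp
          have "7\<^sup>2 \<le> K\<^sup>2" using Q by (intro power_mono) (auto simp: K_def)
          then have "48 * h\<^sup>2 \<le> K\<^sup>2 * h\<^sup>2" by (intro mult_right_mono) auto
          then show "48 * h\<^sup>2 \<le> (h * K)\<^sup>2" by (simp add: power_mult_distrib mult.commute)
          show "7 * Q * h \<le> h * K" using h1 Q by (simp add: K_def)
        qed
        have "1 \<le> 48 * h\<^sup>2 * (7 * Q * h) ^ (3 * L\<^sup>2) * \<bar>x - \<beta>\<bar>"
          by (rule distance_to_quadratic_root[OF root])
        also have "\<dots> \<le> (h * K)\<^sup>2 * (h * K) ^ (3 * L\<^sup>2) * \<bar>x - \<beta>\<bar>"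
          by (intro mult_right_mono mult_mono g(2) power_mono g(3)) (use h1 Q in auto)
        also have "\<dots> = (h * K) ^ (2 + 3 * L\<^sup>2) * \<bar>x - \<beta>\<bar>"
          by (simp only: power_add)
        also have "\<dots> \<le> (h * h) ^ (2 + 3 * L\<^sup>2) * \<bar>x - \<beta>\<bar>"
          using hK h1 Q by (intro mult_right_mono power_mono mult_left_mono) (auto simp: K_def)
        also have "(h * h) ^ (2 + 3 * L\<^sup>2) = h ^ W"
          unfolding W_def by (simp only: power_mult power2_eq_square)
        finally have "1 \<le> h ^ W * \<bar>x - \<beta>\<bar>" .
        also have "\<dots> < h ^ W * h powr (- \<omega> - 1)"
          using close h1 by (intro mult_strict_left_mono) (auto simp: h_def)
        also have "\<dots> = h powr (real W - \<omega> - 1)"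
          using h1 by (simp add: powr_realpow[symmetric] powr_add[symmetric] algebra_simps)
        also have "\<dots> \<le> h powr 0" using \<omega> h1 by (intro powr_mono) auto
        finally show False using h1 by simp
      qed
      with root show "\<beta> \<in> {\<beta>. int_quadratic_root K \<beta>}"
        by (auto intro: int_quadratic_root_mono)
    qed
    with inf finite_int_quadratic_root show False by (auto dest: finite_subset)
  qed
  then have "w_exponent 2 x \<le> ereal (real W)"
    unfolding w_exponent_def by (intro Sup_least) auto
  then show ?thesis unfolding quadratically_Liouville_def by auto
qed

end

section \<open>The lacunary continued fraction\<close>

theorem theorem5p8:
  fixes D :: "nat set"
  assumes "finite D" and "0 \<notin> D" and "card D \<ge> 2"
  shows "\<exists>x \<in> cf_set D. quadratically_very_well_approximable x \<and> \<not> quadratically_Liouville x"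
proof -
  obtain a b where ab: "a \<in> D" "b \<in> D" "a \<noteq> b"
    using assms(3) by (metis card_le_Suc0_iff_eq assms(1) not_less_eq_eq numeral_2_eq_2)
  define M where "M = Max D"
  have D: "n \<in> {1..M}" if "n \<in> D" for n
    using that assms by (auto simp: M_def Suc_le_eq intro: gr0I)
  have M1: "1 \<le> M" using D[OF ab(1)] by auto
  define c where "c = (real M + 1) / (real M + 2)"
  \<comment> \<open>The expansion of \<open>e k\<close> below is constant from index \<open>Suc (L ^ k)\<close> on, which gives the height
    bound \<open>(M + 1) ^ (2 * Suc (L ^ k) + 1)\<close>, and \<open>2 * Suc n + 1 \<le> 5 * n\<close> for \<open>n \<ge> 1\<close>.\<close>
  define Q where "Q = (real M + 1) ^ 5"
  have c: "0 < c" "c < 1" by (auto simp: c_def)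
  have "(1 + 1) ^ 1 \<le> Q"
    unfolding Q_def using M1 by (intro order_trans[OF power_increasing power_mono]) auto
  then have Q: "2 \<le> Q" by simp
  obtain N where N: "c ^ N < 1 / Q ^ 5"
    using real_arch_pow_inv[of "1 / Q ^ 5" c] c Q by auto
  define L where "L = N + 2"
  have L: "2 \<le> L" by (simp add: L_def)
  have "c ^ L \<le> c ^ N" unfolding L_def using c by (intro power_decreasing) auto
  with N have cL: "c ^ L \<le> 1 / Q ^ 5" by linarith

  \<comment> \<open>Sequences are indexed from \<open>0\<close>, so \<open>d i\<close> is the partial quotient number \<open>Suc i\<close>.\<close>
  define d where "d i = (if i \<in> range (\<lambda>k. L ^ k) then b else a)" for i
  define e where "e k i = (if i \<le> L ^ k then d i else a)" for k i
  have dD: "d i \<in> D" and eD: "e k i \<in> D" for k i using ab by (auto simp: d_def e_def)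
  have d: "range d \<subseteq> {1..M}" and e: "range (e k) \<subseteq> {1..M}" for k
    by (intro image_subsetI D dD eD)+
  have agree: "d i = e k i" if "i < L ^ Suc k" for i k
  proof (cases "i \<le> L ^ k")
    case False
    have "i \<noteq> L ^ j" for j
    proof
      assume "i = L ^ j"
      with that False have "L ^ j < L ^ Suc k" "L ^ k < L ^ j" by auto
      moreover have "1 < L" using L by simp
      ultimately have "j < Suc k" "k < j" by (blast dest: power_less_imp_less_exp)+
      then show False by simp
    qed
    with False show ?thesis by (auto simp: d_def e_def)
  qed (simp add: e_def)
  have "e j \<noteq> e k" if "j < k" for j k
  proof -
    have "L ^ j < L ^ k" using that L by (intro power_strict_increasing) auto
    then have "e j (L ^ k) = a" "e k (L ^ k) = b" by (auto simp: e_def d_def)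
    with ab show ?thesis by metis
  qed
  then have e_inj: "inj e" by (rule linorder_injI)

  interpret quadratic_approximations "cf_value d" "\<lambda>k. cf_value (e k)" Q L
  proof
    show "0 < cf_value d" "cf_value d < 1" by (rule cf_value_bounds[OF d])+
    show "inj (\<lambda>k. cf_value (e k))"
      by (rule injI) (use cf_value_inject[OF e e] injD[OF e_inj] in blast)
    fix k
    show "cf_value (e k) \<notin> \<rat>" by (rule cf_value_irrational[OF e])
    show "0 < cf_value (e k)" "cf_value (e k) < 1" by (rule cf_value_bounds[OF e])+
    have Lk: "1 \<le> L ^ k" using L by simp
    have "int_quadratic_root ((real M + 1) ^ (2 * Suc (L ^ k) + 1)) (cf_value (e k))"
      by (rule cf_value_eventually_constant_root[OF e]) (simp add: e_def)
    moreover have "(real M + 1) ^ (2 * Suc (L ^ k) + 1) \<le> (real M + 1) ^ (5 * L ^ k)"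
      using Lk by (intro power_increasing) auto
    ultimately show "int_quadratic_root (Q ^ L ^ k) (cf_value (e k))"
      unfolding Q_def power_mult[symmetric] by (rule int_quadratic_root_mono)
    have "\<bar>cf_value d - cf_value (e k)\<bar> \<le> c ^ L ^ Suc k"
      unfolding c_def by (rule cf_value_close[OF d e]) (rule agree)
    also have "\<dots> = (c ^ L) ^ L ^ k" by (simp add: power_mult)
    also have "\<dots> \<le> (1 / Q ^ 5) ^ L ^ k" using cL c by (intro power_mono) auto
    also have "\<dots> = 1 / (Q ^ L ^ k) ^ 5"
      by (simp add: power_divide power_mult[symmetric] mult.commute)
    finally show "\<bar>cf_value d - cf_value (e k)\<bar> * (Q ^ L ^ k) ^ 5 \<le> 1"
      using Q by (simp add: field_simps)
  qed (fact Q L)+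
  show ?thesis
    using cf_value_in_cf_set[OF d dD] very_well_approximable not_Liouville by (intro bexI conjI)
qed

end
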